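(* Let $d>1$ and, for real constants $l_{i,j}$ ($1\le i,j\le d$), $s_i$ ($1\le i\le d$), let $$\alpha_{i,j}=-l_{i,j}x_j\ (i\ne j),\quad B_i=-x_i+s_i,\quad \beta_i=\sum_{k\ne i}l_{i,k}x_k+(l_{i,i}-1)x_i+s_i,\quad \gamma_i=x_i\sum_{k=1}^dl_{k,i},$$ with $\gamma_i\neq0$ for all $i$. Assume that $l_{i,j}\neq0$ for all $1\le i\ne j\le d$. Then the most general solution of the compatibility conditions, i.e. of the polynomial identities (for all $1\le i\ne j\le d$) $$\alpha_{i,j}(x-e_i)\beta_j(x-e_j)\gamma_i(x)=\alpha_{j,i}(x-e_j)\beta_i(x-e_i)\gamma_j(x),$$ $$\beta_i(x-e_i)\beta_j(x-e_i-e_j)\gamma_j(x)\gamma_i(x-e_j)=\beta_j(x-e_j)\beta_i(x-e_i-e_j)\gamma_i(x)\gamma_j(x-e_i),$$ is given by $$\alpha_{i,j}=-l_ix_j\ (i\ne j),\quad B_i=-x_i+l_is,\quad \beta_i=l_i\Big(\sum_{k=1}^dx_k+s\Big),\quad \gamma_i=x_i\Big(\sum_{k=1}^dl_k+1\Big),$$ where $s$ and $\{l_i\}_{i=1}^d$ are free parameters.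
   Context: $x=(x_1,\dots,x_d)$, $\{e_1,\dots,e_d\}$ is the standard basis of $\mathbb{R}^d$. The $\alpha_{i,j},\beta_i,\gamma_i$ are the coefficients of $D=\sum_{i\ne j}\alpha_{i,j}E_iE_j^{-1}+\sum_i\beta_iE_i+\sum_i\gamma_iE_i^{-1}+\delta\,\mathrm{Id}$, $E_if(x)=f(x+e_i)$, and $B_i$ is the coefficient of $\triangle_i=E_i-\mathrm{Id}$ when $D$ is written as $\sum_{i,j}A_{i,j}\triangle_i\nabla_j+\sum_iB_i\triangle_i$, $\nabla_j=\mathrm{Id}-E_j^{-1}$. "$\gamma_i\ne0$" means not identically zero. The parameters in the solution are free subject to the assumptions made ($l_i\ne0$, $\sum_kl_k+1\ne0$). The form considered is the one with $a=0$, $b=-1$ (linear eigenvalue). *)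

theory Defs
  imports "HOL-Analysis.Analysis"
begin

text \<open>
  The space of dimension \<open>d\<close> is \<open>real ^ 'n\<close> with \<open>d = CARD('n)\<close>, and \<open>axis i 1\<close> is the
  standard basis vector \<open>e\<^sub>i\<close>.  Coefficients are functions \<open>real ^ 'n \<Rightarrow> real\<close>.  A polynomial
  identity is an identity of functions on all of \<open>real ^ 'n\<close>, which is the same thing since the
  reals are infinite.
\<close>

type_synonym 'n coeff = "real ^ 'n \<Rightarrow> real"

definition shift :: "'n::finite \<Rightarrow> 'n coeff \<Rightarrow> 'n coeff" where
  "shift i f = (\<lambda>x. f (x + axis i 1))"

definition shift_inv :: "'n::finite \<Rightarrow> 'n coeff \<Rightarrow> 'n coeff" where
  "shift_inv i f = (\<lambda>x. f (x - axis i 1))"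

definition forward_diff :: "'n::finite \<Rightarrow> 'n coeff \<Rightarrow> 'n coeff" where
  "forward_diff i f = (\<lambda>x. shift i f x - f x)"

definition backward_diff :: "'n::finite \<Rightarrow> 'n coeff \<Rightarrow> 'n coeff" where
  "backward_diff j f = (\<lambda>x. f x - shift_inv j f x)"

text \<open>In \<open>shift_form\<close> the diagonal entries \<open>\<alpha> i i\<close> play no role.\<close>

definition shift_form ::
  "('n::finite \<Rightarrow> 'n \<Rightarrow> 'n coeff) \<Rightarrow> ('n \<Rightarrow> 'n coeff) \<Rightarrow> ('n \<Rightarrow> 'n coeff) \<Rightarrow> 'n coeff
    \<Rightarrow> 'n coeff \<Rightarrow> 'n coeff" where
  "shift_form \<alpha> \<beta> \<gamma> \<delta> f = (\<lambda>x.
      (\<Sum>i\<in>UNIV. \<Sum>j\<in>UNIV - {i}. \<alpha> i j x * shift i (shift_inv j f) x)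
    + (\<Sum>i\<in>UNIV. \<beta> i x * shift i f x)
    + (\<Sum>i\<in>UNIV. \<gamma> i x * shift_inv i f x)
    + \<delta> x * f x)"

definition difference_form ::
  "('n::finite \<Rightarrow> 'n \<Rightarrow> 'n coeff) \<Rightarrow> ('n \<Rightarrow> 'n coeff) \<Rightarrow> 'n coeff \<Rightarrow> 'n coeff" where
  "difference_form A B f = (\<lambda>x.
      (\<Sum>i\<in>UNIV. \<Sum>j\<in>UNIV. A i j x * forward_diff i (backward_diff j f) x)
    + (\<Sum>i\<in>UNIV. B i x * forward_diff i f x))"

text \<open>
  \<open>B i\<close> is the coefficient of the \<open>i\<close>-th forward difference in the operator whose shift
  coefficients are \<open>\<alpha>\<close>, \<open>\<beta>\<close>, \<open>\<gamma>\<close>.  The equation is between operators on all functions on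
  \<open>real ^ 'n\<close>, so comparing coefficients of the shifts determines \<open>A\<close>, \<open>B\<close> and \<open>\<delta>\<close>
  uniquely from \<open>\<alpha>\<close>, \<open>\<beta>\<close>, \<open>\<gamma>\<close>.
\<close>

definition forward_diff_coeffs ::
  "('n::finite \<Rightarrow> 'n \<Rightarrow> 'n coeff) \<Rightarrow> ('n \<Rightarrow> 'n coeff) \<Rightarrow> ('n \<Rightarrow> 'n coeff)
    \<Rightarrow> ('n \<Rightarrow> 'n coeff) \<Rightarrow> bool" where
  "forward_diff_coeffs \<alpha> \<beta> \<gamma> B \<longleftrightarrow>
    (\<exists>\<delta> A. shift_form \<alpha> \<beta> \<gamma> \<delta> = difference_form A B)"

definition compatible ::
  "('n::finite \<Rightarrow> 'n \<Rightarrow> 'n coeff) \<Rightarrow> ('n \<Rightarrow> 'n coeff) \<Rightarrow> ('n \<Rightarrow> 'n coeff) \<Rightarrow> bool" where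
  "compatible \<alpha> \<beta> \<gamma> \<longleftrightarrow> (\<forall>i j. i \<noteq> j \<longrightarrow>
     (\<forall>x. \<alpha> i j (x - axis i 1) * \<beta> j (x - axis j 1) * \<gamma> i x
          = \<alpha> j i (x - axis j 1) * \<beta> i (x - axis i 1) * \<gamma> j x)
   \<and> (\<forall>x. \<beta> i (x - axis i 1) * \<beta> j (x - axis i 1 - axis j 1) * \<gamma> j x * \<gamma> i (x - axis j 1)
          = \<beta> j (x - axis j 1) * \<beta> i (x - axis i 1 - axis j 1) * \<gamma> i x * \<gamma> j (x - axis i 1)))"

definition linear_ansatz ::
  "('n::finite \<Rightarrow> 'n \<Rightarrow> real) \<Rightarrow> ('n \<Rightarrow> real)
    \<Rightarrow> ('n \<Rightarrow> 'n \<Rightarrow> 'n coeff) \<Rightarrow> ('n \<Rightarrow> 'n coeff) \<Rightarrow> ('n \<Rightarrow> 'n coeff) \<Rightarrow> ('n \<Rightarrow> 'n coeff) \<Rightarrow> bool"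
  where
  "linear_ansatz l s \<alpha> B \<beta> \<gamma> \<longleftrightarrow>
     (\<forall>i j. i \<noteq> j \<longrightarrow> (\<forall>x. \<alpha> i j x = - l i j * x $ j))
   \<and> (\<forall>i x. B i x = - x $ i + s i)
   \<and> (\<forall>i x. \<beta> i x = (\<Sum>k\<in>UNIV - {i}. l i k * x $ k) + (l i i - 1) * x $ i + s i)
   \<and> (\<forall>i x. \<gamma> i x = x $ i * (\<Sum>k\<in>UNIV. l k i))"

definition solution_form ::
  "('n::finite \<Rightarrow> real) \<Rightarrow> real
    \<Rightarrow> ('n \<Rightarrow> 'n \<Rightarrow> 'n coeff) \<Rightarrow> ('n \<Rightarrow> 'n coeff) \<Rightarrow> ('n \<Rightarrow> 'n coeff) \<Rightarrow> ('n \<Rightarrow> 'n coeff) \<Rightarrow> bool"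
  where
  "solution_form l s \<alpha> B \<beta> \<gamma> \<longleftrightarrow>
     (\<forall>i j. i \<noteq> j \<longrightarrow> (\<forall>x. \<alpha> i j x = - l i * x $ j))
   \<and> (\<forall>i x. B i x = - x $ i + l i * s)
   \<and> (\<forall>i x. \<beta> i x = l i * ((\<Sum>k\<in>UNIV. x $ k) + s))
   \<and> (\<forall>i x. \<gamma> i x = x $ i * ((\<Sum>k\<in>UNIV. l k) + 1))"

end

theory Submission
  imports Defs
begin

text \<open>
  Write \<open>\<beta>\<^sub>i(x) = m\<^sub>i \<bullet> x + s\<^sub>i\<close> with \<open>m\<^sub>i\<^sub>j = l\<^sub>i\<^sub>j\<close> for \<open>j \<noteq> i\<close> and \<open>m\<^sub>i\<^sub>i = l\<^sub>i\<^sub>i - 1\<close>, and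
  \<open>\<gamma>\<^sub>i(x) = G\<^sub>i x\<^sub>i\<close> with \<open>G\<^sub>i \<noteq> 0\<close>.  Both compatibility conditions carry the factor \<open>x\<^sub>i x\<^sub>j\<close>, which
  cancels by density and continuity (\<open>eq_if_eq_off_coordinate_hyperplanes\<close>).  The first condition
  becomes \<open>l\<^sub>i\<^sub>j G\<^sub>i \<beta>\<^sub>j(x - e\<^sub>j) = l\<^sub>j\<^sub>i G\<^sub>j \<beta>\<^sub>i(x - e\<^sub>i)\<close>: the two shifted linear forms are proportional
  with nonzero constants.  Eliminating \<open>\<beta>\<^sub>j\<close> from the second condition then leaves
  \<open>\<beta>\<^sub>i(x) (m\<^sub>i\<^sub>j - m\<^sub>i\<^sub>i) = 0\<close>, and \<open>\<beta>\<^sub>i\<close> is not zero because \<open>m\<^sub>i\<^sub>j \<noteq> 0\<close>; hence \<open>m\<^sub>i\<^sub>j = m\<^sub>i\<^sub>i\<close>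
  (\<open>affine_coeffs_eq\<close>).  So \<open>\<beta>\<^sub>i\<close> depends only on \<open>\<Sum>\<^sub>k x\<^sub>k\<close>, with slope \<open>l\<^sub>i = m\<^sub>i\<^sub>i\<close>, and
  \<open>G\<^sub>i = \<Sum>\<^sub>k l\<^sub>k + 1\<close> no longer depends on \<open>i\<close>.  What remains of the proportionality is
  \<open>l\<^sub>i s\<^sub>j = l\<^sub>j s\<^sub>i\<close>, that is, \<open>s\<^sub>i = l\<^sub>i s\<close> for a common \<open>s\<close>.

  Conversely the stated family satisfies the compatibility conditions by inspection, and its \<open>B\<^sub>i\<close>
  are the coefficients of the forward differences when one takes
  \<open>A\<^sub>i\<^sub>j = l\<^sub>i x\<^sub>j\<close> for \<open>i \<noteq> j\<close> and \<open>A\<^sub>i\<^sub>i = (l\<^sub>i + 1) x\<^sub>i\<close>.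
\<close>

section \<open>Shift form and difference form\<close>

text \<open>
  Expanding \<open>\<triangle>\<^sub>i\<nabla>\<^sub>j = E\<^sub>i - Id - E\<^sub>i E\<^sub>j\<^sup>-\<^sup>1 + E\<^sub>j\<^sup>-\<^sup>1\<close> shows which relations between the coefficients make
  the two forms of the operator agree; the diagonal terms \<open>E\<^sub>i E\<^sub>i\<^sup>-\<^sup>1\<close> go into \<open>\<delta>\<close>.
\<close>

lemma forward_diff_coeffsI:
  fixes A :: "'n::finite \<Rightarrow> 'n \<Rightarrow> 'n coeff"
  assumes \<alpha>: "\<And>i j x. i \<noteq> j \<Longrightarrow> \<alpha> i j x = - A i j x"
    and \<beta>: "\<And>i x. \<beta> i x = (\<Sum>j\<in>UNIV. A i j x) + B i x"
    and \<gamma>: "\<And>j x. \<gamma> j x = (\<Sum>i\<in>UNIV. A i j x)"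
  shows "forward_diff_coeffs \<alpha> \<beta> \<gamma> B"
proof -
  define \<delta> where
    "\<delta> = (\<lambda>x. - (\<Sum>i\<in>UNIV. \<Sum>j\<in>UNIV. A i j x) - (\<Sum>i\<in>UNIV. A i i x) - (\<Sum>i\<in>UNIV. B i x))"
  have "shift_form \<alpha> \<beta> \<gamma> \<delta> f x = difference_form A B f x" for f x
  proof -
    let ?F = "\<lambda>i. f (x + axis i 1)" and ?H = "\<lambda>j. f (x - axis j 1)"
    let ?M = "\<lambda>i j. f (x + axis i 1 - axis j 1)"
    have off_diag: "(\<Sum>j\<in>UNIV - {i}. \<alpha> i j x * ?M i j) = A i i x * f x - (\<Sum>j\<in>UNIV. A i j x * ?M i j)"
      for i
    proof -
      have "(\<Sum>j\<in>UNIV - {i}. \<alpha> i j x * ?M i j) = (\<Sum>j\<in>UNIV - {i}. - (A i j x * ?M i j))"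
        by (rule sum.cong) (auto simp: \<alpha>)
      moreover have "(\<Sum>j\<in>UNIV. A i j x * ?M i j)
          = A i i x * f x + (\<Sum>j\<in>UNIV - {i}. A i j x * ?M i j)"
        by (subst sum.remove[of UNIV i]) auto
      ultimately show ?thesis
        by (simp add: sum_negf)
    qed
    have swap: "(\<Sum>i\<in>UNIV. \<gamma> i x * ?H i) = (\<Sum>i\<in>UNIV. \<Sum>j\<in>UNIV. A i j x * ?H j)"
      by (simp add: \<gamma> sum_distrib_right) (rule sum.swap)
    show ?thesis
      unfolding shift_form_def difference_form_def forward_diff_def backward_diff_def
        shift_def shift_inv_def swap off_diag \<delta>_def \<beta>
      by (simp add: algebra_simps sum.distrib sum_subtractf sum_distrib_left sum_distrib_right)
  qed
  then show ?thesis
    unfolding forward_diff_coeffs_def by blast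
qed

section \<open>Cancelling coordinate factors\<close>

lemma eq_if_eq_off_coordinate_hyperplanes:
  fixes f g :: "real ^ 'n \<Rightarrow> real"
  assumes "continuous_on UNIV f" "continuous_on UNIV g"
    and eq: "\<And>x. x $ i \<noteq> 0 \<Longrightarrow> x $ j \<noteq> 0 \<Longrightarrow> f x = g x"
  shows "f = g"
proof -
  let ?Z = "\<lambda>k. {x :: real ^ 'n. axis k 1 \<bullet> x = 0}"
  have int: "interior (?Z k) = {}" for k
    by (rule interior_hyperplane) simp
  have "interior (?Z i \<union> ?Z j) = {}"
    using interior_closed_Un_empty_interior[OF closed_hyperplane int, of "axis i 1" 0 j] int by simp
  moreover have "{x. f x \<noteq> g x} \<subseteq> ?Z i \<union> ?Z j"
    using eq by (auto simp: inner_axis')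
  moreover have "open {x. f x \<noteq> g x}"
    using assms(1,2) by (rule open_Collect_neq)
  ultimately have "{x. f x \<noteq> g x} = {}"
    using interior_maximal[of "{x. f x \<noteq> g x}" "?Z i \<union> ?Z j"] by auto
  then show "f = g" by auto
qed

section \<open>Two affine functions subject to the compatibility conditions\<close>

text \<open>
  Here \<open>b\<close> and \<open>c\<close> stand for \<open>\<beta>\<^sub>i\<close> and \<open>\<beta>\<^sub>j\<close>.  The relation \<open>cross\<close> replaces \<open>c\<close> by \<open>b\<close> in \<open>quad\<close>, leaving
  \<open>b(x) b(x - e\<^sub>i) = b(x) b(x - e\<^sub>j)\<close>, whose two sides differ by \<open>b(x) (m\<^sub>j - m\<^sub>i)\<close>.
\<close>

lemma affine_coeffs_eq:
  fixes b c :: "real ^ 'n \<Rightarrow> real"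
  assumes b: "\<And>x. b x = m \<bullet> x + s"
    and cross: "\<And>x. p * c (x - axis j 1) = q * b (x - axis i 1)"
    and quad: "\<And>x. b (x - axis i 1) * c (x - axis i 1 - axis j 1)
                 = c (x - axis j 1) * b (x - axis i 1 - axis j 1)"
    and "q \<noteq> 0" "m $ j \<noteq> 0"
  shows "m $ i = m $ j"
proof -
  have "b x * (m $ j - m $ i) = 0" for x
  proof -
    let ?y = "x + axis i 1"
    have 1: "p * c (x - axis j 1) = q * b (x - axis i 1)"
      by (rule cross)
    have 2: "p * c (?y - axis j 1) = q * b x"
      using cross[of ?y] by simp
    have 3: "b x * c (x - axis j 1) = c (?y - axis j 1) * b (x - axis j 1)"
      using quad[of ?y] by simp
    have "q * (b x * b (x - axis i 1)) = b x * (p * c (x - axis j 1))"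
      by (simp add: 1)
    also have "\<dots> = (p * c (?y - axis j 1)) * b (x - axis j 1)"
      using 3 by simp
    also have "\<dots> = q * (b x * b (x - axis j 1))"
      by (simp add: 2)
    finally have "b x * b (x - axis i 1) = b x * b (x - axis j 1)"
      using \<open>q \<noteq> 0\<close> by simp
    then show ?thesis
      by (simp add: b inner_diff_right inner_axis algebra_simps)
  qed
  \<comment> \<open>\<open>b\<close> cannot vanish at both \<open>0\<close> and \<open>e\<^sub>j\<close>, since its values there differ by \<open>m\<^sub>j\<close>.\<close>
  from this[of 0] this[of "axis j 1"] show ?thesis
    using \<open>m $ j \<noteq> 0\<close> by (auto simp: b inner_axis)
qed

section \<open>The general solution\<close>

text \<open>
  The shifts do not affect the factors \<open>x\<^sub>j\<close> in \<open>\<alpha>\<^sub>i\<^sub>j(x - e\<^sub>i)\<close> and \<open>x\<^sub>i\<close> in \<open>\<gamma>\<^sub>i(x - e\<^sub>j)\<close>, which is why both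
  conditions contain the factor \<open>x\<^sub>i x\<^sub>j\<close>.
\<close>

lemma compatible_linear_coeffs:
  fixes \<alpha> :: "'n::finite \<Rightarrow> 'n \<Rightarrow> 'n coeff"
  assumes comp: "compatible \<alpha> \<beta> \<gamma>" and "i \<noteq> j"
    and \<alpha>: "\<And>i j x. i \<noteq> j \<Longrightarrow> \<alpha> i j x = - l i j * x $ j"
    and \<beta>: "\<And>i x. \<beta> i x = m i \<bullet> x + s i"
    and \<gamma>: "\<And>i x. \<gamma> i x = x $ i * G i"
    and G: "\<And>i. G i \<noteq> 0"
  shows "l i j * G i * \<beta> j (x - axis j 1) = l j i * G j * \<beta> i (x - axis i 1)"
    and "\<beta> i (x - axis i 1) * \<beta> j (x - axis i 1 - axis j 1)
       = \<beta> j (x - axis j 1) * \<beta> i (x - axis i 1 - axis j 1)"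
proof -
  note ij = \<open>i \<noteq> j\<close> \<open>i \<noteq> j\<close>[symmetric]
  have ax: "axis i (1::real) $ j = 0" "axis j (1::real) $ i = 0"
    using ij by (auto simp: axis_def)
  have c1: "\<alpha> i j (x - axis i 1) * \<beta> j (x - axis j 1) * \<gamma> i x
      = \<alpha> j i (x - axis j 1) * \<beta> i (x - axis i 1) * \<gamma> j x"
    and c2: "\<beta> i (x - axis i 1) * \<beta> j (x - axis i 1 - axis j 1) * \<gamma> j x * \<gamma> i (x - axis j 1)
      = \<beta> j (x - axis j 1) * \<beta> i (x - axis i 1 - axis j 1) * \<gamma> i x * \<gamma> j (x - axis i 1)" for x
    using comp ij(1) unfolding compatible_def by blast+
  have cont: "continuous_on UNIV (\<lambda>x. \<beta> k (x - a))" "continuous_on UNIV (\<lambda>x. \<beta> k (x - a - a'))"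
    for k a a'
    unfolding \<beta> by (intro continuous_intros)+
  have "(\<lambda>x. l i j * G i * \<beta> j (x - axis j 1)) = (\<lambda>x. l j i * G j * \<beta> i (x - axis i 1))"
  proof (rule eq_if_eq_off_coordinate_hyperplanes[where i = i and j = j])
    fix x :: "real ^ 'n" assume "x $ i \<noteq> 0" "x $ j \<noteq> 0"
    moreover have "(x $ i * x $ j) * (l i j * G i * \<beta> j (x - axis j 1))
        = (x $ i * x $ j) * (l j i * G j * \<beta> i (x - axis i 1))"
      using c1[of x] by (simp add: \<alpha>[OF ij(1)] \<alpha>[OF ij(2)] \<gamma> ax mult_ac)
    ultimately show "l i j * G i * \<beta> j (x - axis j 1) = l j i * G j * \<beta> i (x - axis i 1)"
      by (metis mult_cancel_left no_zero_divisors)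
  qed (intro continuous_intros cont)+
  then show "l i j * G i * \<beta> j (x - axis j 1) = l j i * G j * \<beta> i (x - axis i 1)"
    unfolding fun_eq_iff by blast
  have "(\<lambda>x. \<beta> i (x - axis i 1) * \<beta> j (x - axis i 1 - axis j 1))
      = (\<lambda>x. \<beta> j (x - axis j 1) * \<beta> i (x - axis i 1 - axis j 1))"
  proof (rule eq_if_eq_off_coordinate_hyperplanes[where i = i and j = j])
    fix x :: "real ^ 'n" assume "x $ i \<noteq> 0" "x $ j \<noteq> 0"
    then have "x $ i * x $ j * G i * G j \<noteq> 0"
      using G by simp
    moreover have "(x $ i * x $ j * G i * G j) * (\<beta> i (x - axis i 1) * \<beta> j (x - axis i 1 - axis j 1))
        = (x $ i * x $ j * G i * G j) * (\<beta> j (x - axis j 1) * \<beta> i (x - axis i 1 - axis j 1))"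
      using c2[of x] by (simp only: \<gamma> ax vector_minus_component mult_ac diff_zero)
    ultimately show "\<beta> i (x - axis i 1) * \<beta> j (x - axis i 1 - axis j 1)
        = \<beta> j (x - axis j 1) * \<beta> i (x - axis i 1 - axis j 1)"
      by (metis mult_cancel_left)
  qed (intro continuous_intros cont)+
  then show "\<beta> i (x - axis i 1) * \<beta> j (x - axis i 1 - axis j 1)
      = \<beta> j (x - axis j 1) * \<beta> i (x - axis i 1 - axis j 1)"
    unfolding fun_eq_iff by blast
qed

lemma solution_form_if_compatible:
  fixes \<alpha> :: "'n::finite \<Rightarrow> 'n \<Rightarrow> 'n coeff"
  assumes card: "CARD('n) > 1"
    and comp: "compatible \<alpha> \<beta> \<gamma>"
    and \<gamma>_nz: "\<And>i. \<exists>x. \<gamma> i x \<noteq> 0"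
    and ansatz: "linear_ansatz l s \<alpha> B \<beta> \<gamma>"
    and l_nz: "\<And>i j. i \<noteq> j \<Longrightarrow> l i j \<noteq> 0"
  shows "\<exists>(l :: 'n \<Rightarrow> real) (s :: real).
           (\<forall>i. l i \<noteq> 0) \<and> (\<Sum>k\<in>UNIV. l k) + 1 \<noteq> 0 \<and> solution_form l s \<alpha> B \<beta> \<gamma>"
proof -
  define m :: "'n \<Rightarrow> real ^ 'n" where "m i = (\<chi> k. if k = i then l i i - 1 else l i k)" for i
  define G where "G i = (\<Sum>k\<in>UNIV. l k i)" for i
  define L where "L i = m i $ i" for i
  have \<alpha>: "\<alpha> i j x = - l i j * x $ j" if "i \<noteq> j" for i j x
    using ansatz that by (simp add: linear_ansatz_def)
  have B: "B i x = - x $ i + s i" for i x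
    using ansatz by (simp add: linear_ansatz_def)
  have \<gamma>: "\<gamma> i x = x $ i * G i" for i x
    using ansatz by (simp add: linear_ansatz_def G_def)
  have \<beta>: "\<beta> i x = m i \<bullet> x + s i" for i x
  proof -
    have "m i \<bullet> x = (\<Sum>k\<in>UNIV - {i}. m i $ k * x $ k) + m i $ i * x $ i"
      by (simp add: inner_vec_def sum.remove[of UNIV i])
    also have "(\<Sum>k\<in>UNIV - {i}. m i $ k * x $ k) = (\<Sum>k\<in>UNIV - {i}. l i k * x $ k)"
      by (rule sum.cong) (auto simp: m_def)
    finally show ?thesis
      using ansatz by (simp add: linear_ansatz_def m_def)
  qed
  have G_nz: "G i \<noteq> 0" for i
    using \<gamma>_nz[of i] by (auto simp: \<gamma>)
  have m_off: "m i $ j = l i j" if "i \<noteq> j" for i j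
    using that by (simp add: m_def)
  note lin = compatible_linear_coeffs[where l = l and G = G, OF comp _ \<alpha> \<beta> \<gamma> G_nz]
  have m_diag: "m i $ j = L i" for i j
  proof (cases "i = j")
    case False
    have "m i $ i = m i $ j"
    proof (rule affine_coeffs_eq[of "\<beta> i" _ "s i" "l i j * G i" "\<beta> j" j "l j i * G j"])
      show "l j i * G j \<noteq> 0" "m i $ j \<noteq> 0"
        using False l_nz G_nz m_off by auto
    qed (use lin[OF False] \<beta> in auto)
    then show ?thesis by (simp add: L_def)
  qed (simp add: L_def)
  have l_eq: "l i j = L i" if "i \<noteq> j" for i j
    using m_off[OF that] m_diag by simp
  have L_nz: "L i \<noteq> 0" for i
  proof -
    obtain j where "j \<noteq> i"
      using card by (metis (full_types) card_1_singleton_iff One_nat_def less_irrefl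
          UNIV_eq_I singletonI)
    then show ?thesis using l_nz[of i j] l_eq[of i j] by simp
  qed
  have G_eq: "G i = (\<Sum>k\<in>UNIV. L k) + 1" for i
  proof -
    have "G i = l i i + (\<Sum>k\<in>UNIV - {i}. l k i)"
      by (simp add: G_def sum.remove[of UNIV i])
    also have "(\<Sum>k\<in>UNIV - {i}. l k i) = (\<Sum>k\<in>UNIV - {i}. L k)"
      by (rule sum.cong) (auto simp: l_eq)
    also have "l i i = L i + 1"
      by (simp add: L_def m_def)
    finally show ?thesis
      by (simp add: sum.remove[of UNIV i])
  qed
  have s_prop: "L i * s j = L j * s i" for i j
  proof (cases "i = j")
    case False
    \<comment> \<open>The constant terms of the first compatibility condition, read off at \<open>x = 0\<close>.\<close>
    let ?G = "(\<Sum>k\<in>UNIV. L k) + 1"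
    have "?G \<noteq> 0" using G_nz G_eq by metis
    moreover have "?G * (L i * (s j - L j)) = ?G * (L j * (s i - L i))"
      using lin(1)[OF False, of 0] False
      by (simp add: l_eq G_eq \<beta> inner_axis m_diag mult_ac)
    ultimately have "L i * (s j - L j) = L j * (s i - L i)"
      by (metis mult_cancel_left)
    then show ?thesis by (simp add: algebra_simps)
  qed simp
  obtain i0 :: 'n where True by simp
  define s0 where "s0 = s i0 / L i0"
  have s_eq: "s i = L i * s0" for i
    using s_prop[of i i0] L_nz[of i0] by (simp add: s0_def field_simps)
  have "solution_form L s0 \<alpha> B \<beta> \<gamma>"
    unfolding solution_form_def
    by (simp add: \<alpha> l_eq B \<gamma> G_eq \<beta> s_eq inner_vec_def m_diag sum_distrib_left algebra_simps)
  moreover have "(\<Sum>k\<in>UNIV. L k) + 1 \<noteq> 0"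
    using G_nz G_eq by metis
  ultimately show ?thesis using L_nz by blast
qed

text \<open>
  For a solution, every shifted \<open>\<beta>\<^sub>i\<close> is \<open>l\<^sub>i\<close> times a function of \<open>\<Sum>\<^sub>k x\<^sub>k\<close> alone, and \<open>\<Sum>\<^sub>k x\<^sub>k\<close> drops by one
  under each backward shift, whatever its direction; so both conditions are symmetric in \<open>i\<close> and \<open>j\<close>.
\<close>

lemma compatible_if_solution_form:
  assumes "solution_form l s \<alpha> B \<beta> \<gamma>"
  shows "compatible \<alpha> \<beta> \<gamma>"
proof -
  have sum_axis: "(\<Sum>k\<in>UNIV. axis i (1::real) $ k) = 1" for i :: 'a
    by (simp add: axis_def)
  have "axis i (1::real) $ j = 0" if "i \<noteq> j" for i j :: 'a
    using that by (simp add: axis_def)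
  then show ?thesis
    using assms unfolding compatible_def solution_form_def
    by (simp add: sum_subtractf sum_axis)
qed

lemma forward_diff_coeffs_if_solution_form:
  fixes \<alpha> :: "'n::finite \<Rightarrow> 'n \<Rightarrow> 'n coeff"
  assumes "solution_form l s \<alpha> B \<beta> \<gamma>"
  shows "forward_diff_coeffs \<alpha> \<beta> \<gamma> B"
proof (rule forward_diff_coeffsI[where A = "\<lambda>i j x. (l i + (if i = j then 1 else 0)) * x $ j"])
  fix i and x :: "real ^ 'n"
  show "\<beta> i x = (\<Sum>j\<in>UNIV. (l i + (if i = j then 1 else 0)) * x $ j) + B i x"
    using assms
    by (simp add: solution_form_def distrib_right sum.distrib sum_distrib_left
        if_distrib[of "\<lambda>c. c * _"] distrib_left cong: if_cong)
  show "\<gamma> i x = (\<Sum>k\<in>UNIV. (l k + (if k = i then 1 else 0)) * x $ i)"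
    using assms by (simp add: solution_form_def sum.distrib flip: sum_distrib_right)
qed (use assms in \<open>simp add: solution_form_def\<close>)

text \<open>
  The diagonal of the matrix in the ansatz is \<open>l\<^sub>i + 1\<close>, because \<open>\<beta>\<^sub>i\<close> has the coefficient \<open>l\<^sub>i\<^sub>i - 1\<close> at \<open>x\<^sub>i\<close>.
\<close>

lemma linear_ansatz_if_solution_form:
  fixes \<alpha> :: "'n::finite \<Rightarrow> 'n \<Rightarrow> 'n coeff"
  assumes "solution_form l s \<alpha> B \<beta> \<gamma>"
  shows "linear_ansatz (\<lambda>i j. l i + (if i = j then 1 else 0)) (\<lambda>i. l i * s) \<alpha> B \<beta> \<gamma>"
proof -
  have "(\<Sum>k\<in>UNIV - {i}. (l i + (if i = k then 1 else 0)) * x $ k)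
      = l i * (\<Sum>k\<in>UNIV. x $ k) - l i * x $ i" for i and x :: "real ^ 'n"
  proof -
    have "(\<Sum>k\<in>UNIV - {i}. (l i + (if i = k then 1 else 0)) * x $ k)
        = l i * (\<Sum>k\<in>UNIV - {i}. x $ k)"
      unfolding sum_distrib_left by (rule sum.cong) auto
    then show ?thesis
      by (simp add: sum_diff1 right_diff_distrib)
  qed
  then show ?thesis
    using assms unfolding linear_ansatz_def solution_form_def
    by (simp add: sum.distrib algebra_simps)
qed

theorem proposition6p1:
  fixes \<alpha> :: "'n::finite \<Rightarrow> 'n \<Rightarrow> real ^ 'n \<Rightarrow> real"
    and \<beta> \<gamma> B :: "'n \<Rightarrow> real ^ 'n \<Rightarrow> real"
  assumes "CARD('n) > 1"
  shows "(forward_diff_coeffs \<alpha> \<beta> \<gamma> B \<and> compatible \<alpha> \<beta> \<gamma> \<and>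
          (\<forall>i. \<exists>x. \<gamma> i x \<noteq> 0) \<and>
          (\<exists>(l :: 'n \<Rightarrow> 'n \<Rightarrow> real) (s :: 'n \<Rightarrow> real).
             linear_ansatz l s \<alpha> B \<beta> \<gamma> \<and> (\<forall>i j. i \<noteq> j \<longrightarrow> l i j \<noteq> 0)))
     \<longleftrightarrow> (\<exists>(l :: 'n \<Rightarrow> real) (s :: real).
             (\<forall>i. l i \<noteq> 0) \<and> (\<Sum>k\<in>UNIV. l k) + 1 \<noteq> 0 \<and> solution_form l s \<alpha> B \<beta> \<gamma>)"
    (is "?lhs \<longleftrightarrow> ?rhs")
proof
  assume ?lhs
  then show ?rhs
    using solution_form_if_compatible[OF assms] by blast
next
  assume ?rhs
  then obtain l :: "'n \<Rightarrow> real" and s :: real where l_nz: "\<And>i. l i \<noteq> 0"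
    and G: "(\<Sum>k\<in>UNIV. l k) + 1 \<noteq> 0" and sol: "solution_form l s \<alpha> B \<beta> \<gamma>"
    by blast
  have "\<gamma> i (axis i 1) \<noteq> 0" for i
    using sol G by (simp add: solution_form_def)
  moreover have "i \<noteq> j \<Longrightarrow> l i + (if i = j then 1 else 0) \<noteq> 0" for i j
    using l_nz by simp
  ultimately show ?lhs
    using forward_diff_coeffs_if_solution_form[OF sol] compatible_if_solution_form[OF sol]
      linear_ansatz_if_solution_form[OF sol] by blast
qed

end
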